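(* Let $(G,A)$ be a simple edge-weighted graph on vertices $v_1,\dots,v_n$, and let $(G',A')$ be the result of a finite sequence of collapsing operations on $(G,A)$ which removes the vertices $v_{r+1},\dots,v_n$ (each by one star-clique operation, applied only when the current graph has no multiple edges) and collapses any multiple edges, so that $G'$ has vertices $v_1,\dots,v_r$. Then the map $\phi:S_G\to S_{G'}$, $\phi(g_1,\dots,g_n)=(g_1,\dots,g_r)$, is a surjective $\mathbb{Z}$-module homomorphism with kernel $\mathcal{F}_r\cup\cdots\cup\mathcal{F}_{n-1}\cup\mathcal{F}_n$.
   Context: An edge-weighted graph $(G,A)$ is a finite loopless graph (multiple edges allowed unless "simple" is stated) with a weight function $A$ from its edges to positive integers. A spline on $(G,A)$ with vertices $v_1,\dots,v_n$ is $(g_1,\dots,g_n)\in\mathbb{Z}^n$ with $g_i\equiv g_j\pmod{A(e)}$ for every edge $e$ joining $v_i$ and $v_j$; $S_G$ is the $\mathbb{Z}$-module of splines. Collapsing operations: (a) star-clique on a vertex $v$ (of a graph without multiple edges) with neighbours $w_1,\dots,w_d$ and edge $vw_k$ of weight $a_k$: delete $v$ and its incident edges and, for each pair $j<k$, add a new edge between $w_j$ and $w_k$ of weight $\gcd(a_j,a_k)$ (possibly creating multiple edges); (b) edge collapse: replace edges $e_1,\dots,e_r$ ($r\ge2$) joining the same pair of vertices, of weights $a_1,\dots,a_r$, by one edge of weight $\operatorname{lcm}(a_1,\dots,a_r)$. Flow-up classes of $S_G$: for $0\le i<n$, $\mathcal{F}_i$ is the set of splines with $g_1=\cdots=g_i=0$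 and $g_{i+1}\ne0$; $\mathcal{F}_n=\{0\}$. *)

theory Defs
  imports "Jordan_Normal_Form.VS_Connect" "HOL-Number_Theory.Cong"
begin

text \<open>
  The vertices \<open>v\<^sub>1, \<dots>, v\<^sub>n\<close> are represented by \<open>0, \<dots>, n - 1\<close>, in agreement with the 0-based
  indexing of vectors.
  An edge together with its weight is a pair \<open>({i, j}, a)\<close>. Multiple edges may also have equal
  weights, so the edges form a multiset.
\<close>

record weighted_graph =
  verts :: "nat set"
  edges :: "(nat set \<times> nat) multiset"

definition edge_weighted_graph :: "weighted_graph \<Rightarrow> bool" where
  "edge_weighted_graph G \<longleftrightarrow> finite (verts G) \<and>
     (\<forall>(p, a) \<in> set_mset (edges G). p \<subseteq> verts G \<and> card p = 2 \<and> a > 0)"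

definition no_multiple_edges :: "weighted_graph \<Rightarrow> bool" where
  "no_multiple_edges G \<longleftrightarrow> (\<forall>p. size {#e \<in># edges G. fst e = p#} \<le> 1)"

definition neighbours :: "weighted_graph \<Rightarrow> nat \<Rightarrow> nat set" where
  "neighbours G v = {w. \<exists>a. ({v, w}, a) \<in># edges G}"

text \<open>Meaningful only if exactly one edge joins \<open>v\<close> and \<open>w\<close>.\<close>

definition edge_weight :: "weighted_graph \<Rightarrow> nat \<Rightarrow> nat \<Rightarrow> nat" where
  "edge_weight G v w = (THE a. ({v, w}, a) \<in># edges G)"

text \<open>Here \<open>w < w'\<close> selects each unordered pair of distinct neighbours of \<open>v\<close> once.\<close>

definition star_clique :: "nat \<Rightarrow> weighted_graph \<Rightarrow> weighted_graph" where
  "star_clique v G =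
     \<lparr>verts = verts G - {v},
      edges = {#e \<in># edges G. v \<notin> fst e#} +
        image_mset (\<lambda>(w, w'). ({w, w'}, gcd (edge_weight G v w) (edge_weight G v w')))
          (mset_set {(w, w'). w \<in> neighbours G v \<and> w' \<in> neighbours G v \<and> w < w'})\<rparr>"

text \<open>\<open>M\<close> is the multiset of the parallel edges, all joining the pair \<open>p\<close>, that are merged.\<close>

definition edge_collapse ::
    "nat set \<Rightarrow> (nat set \<times> nat) multiset \<Rightarrow> weighted_graph \<Rightarrow> weighted_graph" where
  "edge_collapse p M G =
     \<lparr>verts = verts G,
      edges = add_mset (p, Lcm (snd ` set_mset M)) (edges G - M)\<rparr>"

inductive collapsing_step :: "weighted_graph \<Rightarrow> weighted_graph \<Rightarrow> bool" where
  star_clique_step: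
    "\<lbrakk>no_multiple_edges G; v \<in> verts G\<rbrakk> \<Longrightarrow> collapsing_step G (star_clique v G)"
| edge_collapse_step:
    "\<lbrakk>M \<subseteq># edges G; size M \<ge> 2; \<forall>e \<in># M. fst e = p\<rbrakk>
       \<Longrightarrow> collapsing_step G (edge_collapse p M G)"

text \<open>The following notions are used for graphs whose vertex set is an initial segment
  \<open>{..<n}\<close> of the natural numbers, so that \<open>card (verts G) = n\<close>.\<close>

definition splines :: "weighted_graph \<Rightarrow> int vec set" where
  "splines G = {g \<in> carrier_vec (card (verts G)).
     \<forall>i j a. ({i, j}, a) \<in># edges G \<longrightarrow> [g $ i = g $ j] (mod int a)}"

definition spline_module :: "weighted_graph \<Rightarrow> (int, int vec) module" where
  "spline_module G = module_vec TYPE(int) (card (verts G)) \<lparr>carrier := splines G\<rparr>"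

definition flow_up_class :: "weighted_graph \<Rightarrow> nat \<Rightarrow> int vec set" where
  "flow_up_class G i =
     (if i < card (verts G) then {g \<in> splines G. (\<forall>j<i. g $ j = 0) \<and> g $ i \<noteq> 0}
      else {0\<^sub>v (card (verts G))})"

end

theory Submission
  imports Defs
begin

text \<open>
  Extending a spline of a star-clique to the deleted vertex \<open>v\<close> amounts to solving a system of
  congruences, one for each neighbour of \<open>v\<close>. The edges added by the star-clique say exactly that
  this system is pairwise compatible, which by the Chinese remainder theorem for arbitrary moduli
  is equivalent to solvability. An edge collapse does not change the splines at all. Hence the
  splines of the collapsed graph are exactly the restrictions of those of the original one.
\<close>

section \<open>The Chinese remainder theorem for arbitrary moduli\<close>

text \<open>Bezout gives u m + v k = gcd m k. If b - a = c gcd m k, then a + c u m solves both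
  congruences.\<close>

lemma binary_chinese_remainder_gcd_int:
  fixes a b m k :: int
  assumes "[a = b] (mod gcd m k)"
  shows "\<exists>x. [x = a] (mod m) \<and> [x = b] (mod k)"
proof -
  obtain u v where uv: "u * m + v * k = gcd m k"
    using bezout_int by blast
  obtain c where "b - a = gcd m k * c"
    using cong_sym[OF assms] by (auto simp: cong_iff_dvd_diff)
  then have "(a + c * u * m) - b = - (c * v) * k"
    unfolding uv[symmetric] by (simp add: algebra_simps)
  then have "[a + c * u * m = b] (mod k)"
    by (simp add: cong_iff_dvd_diff)
  moreover have "[a + c * u * m = a] (mod m)"
    by (simp add: cong_iff_dvd_diff)
  ultimately show ?thesis by blast
qed

text \<open>Since gcd distributes over lcm, divisibility for each modulus passes to the lcm of all
  of them. This turns pairwise compatibility into compatibility with the moduli already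
  treated.\<close>

lemma gcd_Lcm_dvd_int:
  fixes a d :: int
  assumes "finite A" and "\<And>b. b \<in> A \<Longrightarrow> gcd a (m b) dvd d"
  shows "gcd a (Lcm (m ` A)) dvd d"
  using assms
proof (induction A rule: finite_induct)
  case empty
  then show ?case by simp
next
  case (insert b A)
  then show ?case by (simp add: gcd_lcm_distrib)
qed

lemma chinese_remainder_gcd_int:
  fixes m u :: "'a \<Rightarrow> int"
  assumes "finite A"
    and "\<And>i j. i \<in> A \<Longrightarrow> j \<in> A \<Longrightarrow> [u i = u j] (mod gcd (m i) (m j))"
  shows "\<exists>x. \<forall>i\<in>A. [x = u i] (mod m i)"
  using assms
proof (induction A rule: finite_induct)
  case empty
  then show ?case by simp
next
  case (insert b A)
  then obtain x where x: "\<forall>i\<in>A. [x = u i] (mod m i)"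
    by auto
  \<comment> \<open>For each \<open>i\<close> in \<open>A\<close>, both \<open>u b\<close> and
    \<open>x\<close> are congruent to \<open>u i\<close> modulo
    \<open>gcd (m b) (m i)\<close>.\<close>
  have "[u b = x] (mod gcd (m b) (Lcm (m ` A)))"
    unfolding cong_iff_dvd_diff
  proof (rule gcd_Lcm_dvd_int[OF insert.hyps(1)])
    fix i assume i: "i \<in> A"
    have "[u b = u i] (mod gcd (m b) (m i))"
      using insert.prems i by simp
    moreover have "[u i = x] (mod gcd (m b) (m i))"
      using x i by (meson cong_dvd_modulus cong_sym gcd_dvd2)
    ultimately show "gcd (m b) (m i) dvd u b - x"
      using cong_trans cong_iff_dvd_diff by blast
  qed
  from binary_chinese_remainder_gcd_int[OF this]
  obtain y where y: "[y = u b] (mod m b)" "[y = x] (mod Lcm (m ` A))"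
    by blast
  have "[y = u i] (mod m i)" if "i \<in> A" for i
    using y(2) x that by (meson cong_dvd_modulus cong_trans dvd_Lcm imageI)
  with y(1) show ?case by blast
qed

lemma cong_int_Lcm_iff: "[x = y] (mod int (Lcm A)) \<longleftrightarrow> (\<forall>a\<in>A. [x = y] (mod int a))"
  unfolding cong_iff_dvd_diff dvd_nat_abs_iff[symmetric] Lcm_dvd_iff ..

section \<open>Splines as functions on the vertices\<close>

text \<open>Labellings are total functions here, because the vertex sets of the intermediate graphs of
  a collapsing sequence need not be initial segments.\<close>

definition spline_fun :: "weighted_graph \<Rightarrow> (nat \<Rightarrow> int) \<Rightarrow> bool" where
  "spline_fun G f \<longleftrightarrow> (\<forall>i j a. ({i, j}, a) \<in># edges G \<longrightarrow> [f i = f j] (mod int a))"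

text \<open>All edges have their ends in \<open>verts G\<close>, so the values of a total labelling
  elsewhere are irrelevant.\<close>

lemma spline_fun_cong:
  assumes "edge_weighted_graph G" and "\<And>i. i \<in> verts G \<Longrightarrow> f i = g i"
  shows "spline_fun G f \<longleftrightarrow> spline_fun G g"
proof -
  have "f i = g i \<and> f j = g j" if "({i, j}, a) \<in># edges G" for i j a
    using assms that unfolding edge_weighted_graph_def by fastforce
  then show ?thesis
    unfolding spline_fun_def by metis
qed

text \<open>This is the restriction property in the case where no vertex is removed; it serves the
  empty sequence and the edge collapse.\<close>

lemma spline_fun_agree_iff:
  assumes "edge_weighted_graph G"
  shows "(\<exists>g. (\<forall>i\<in>verts G. g i = f i) \<and> spline_fun G g) \<longleftrightarrow> spline_fun G f"
  using spline_fun_cong[OF assms, of _ f] by blast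

lemma splines_eq: "splines G = {g \<in> carrier_vec (card (verts G)). spline_fun G (($) g)}"
  by (simp add: splines_def spline_fun_def)

section \<open>Collapsing operations\<close>

lemma edge_collapse_wf:
  assumes "edge_weighted_graph G" "M \<subseteq># edges G" "size M \<ge> 2" "\<forall>e\<in>#M. fst e = p"
  shows "edge_weighted_graph (edge_collapse p M G)"
proof -
  have E: "q \<subseteq> verts G \<and> card q = 2 \<and> a > 0" if "(q, a) \<in># edges G" for q a
    using assms(1) that unfolding edge_weighted_graph_def by blast
  have M: "(p, a) \<in># edges G" if "a \<in> snd ` set_mset M" for a
    using assms(2,4) that by (force dest: mset_subset_eqD)
  \<comment> \<open>A nonempty \<open>M\<close> makes \<open>p\<close> the pair of ends of an edge
    of \<open>G\<close>.\<close>
  from assms(3) obtain e where "e \<in># M"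
    by (metis multiset_nonemptyE not_numeral_le_zero size_empty)
  then have p: "p \<subseteq> verts G" "card p = 2"
    using M E by blast+
  have "0 \<notin> snd ` set_mset M"
    using M E by blast
  then have "Lcm (snd ` set_mset M) > 0"
    by (intro gr0I) (simp add: Lcm_0_iff)
  then have "q \<subseteq> verts G \<and> card q = 2 \<and> a > 0"
    if "(q, a) \<in># edges (edge_collapse p M G)" for q a
    using that p E[of q a] by (auto simp: edge_collapse_def dest: in_diffD)
  moreover have "verts (edge_collapse p M G) = verts G"
    by (simp add: edge_collapse_def)
  ultimately show ?thesis
    using assms(1) unfolding edge_weighted_graph_def by auto
qed

text \<open>A difference is divisible by an lcm iff it is divisible by every number involved, so the
  new edge imposes exactly the conditions of the merged ones.\<close>

lemma spline_fun_edge_collapse: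
  assumes "M \<subseteq># edges G" "\<forall>e\<in>#M. fst e = p"
  shows "spline_fun (edge_collapse p M G) f \<longleftrightarrow> spline_fun G f"
proof -
  \<comment> \<open>The two cases may overlap: a copy of an edge in \<open>M\<close> can remain in
    \<open>edges G - M\<close>.\<close>
  have split: "e \<in># edges G \<longleftrightarrow> e \<in># edges G - M \<or> e \<in># M" for e
    using assms(1) by (metis subset_mset.diff_add union_iff)
  have M: "({i, j}, a) \<in># M \<longleftrightarrow> {i, j} = p \<and> a \<in> snd ` set_mset M" for i j a
    using assms(2) by force
  have "spline_fun (edge_collapse p M G) f \<longleftrightarrow>
      (\<forall>i j a. ({i, j}, a) \<in># edges G - M \<longrightarrow> [f i = f j] (mod int a)) \<and>
      (\<forall>i j. {i, j} = p \<longrightarrow> (\<forall>a\<in>snd ` set_mset M. [f i = f j] (mod int a)))"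
    unfolding spline_fun_def edge_collapse_def cong_int_Lcm_iff[symmetric] by auto
  also have "\<dots> \<longleftrightarrow> spline_fun G f"
    unfolding spline_fun_def split M by blast
  finally show ?thesis .
qed

section \<open>Star-cliques on a graph without multiple edges\<close>

context
  fixes G :: weighted_graph and v :: nat
  assumes wf: "edge_weighted_graph G" and simple: "no_multiple_edges G"
begin

lemma edge_unique:
  assumes "(p, a) \<in># edges G" "(p, b) \<in># edges G"
  shows "a = b"
proof (rule ccontr)
  assume "a \<noteq> b"
  \<comment> \<open>Different weights make the two edges distinct, so two edges join the pair
    \<open>p\<close>.\<close>
  then have "{#(p, a), (p, b)#} \<subseteq># {#e \<in># edges G. fst e = p#}"
    using assms by (auto simp: insert_subset_eq_iff in_diff_count)
  then have "size {#(p, a), (p, b)#} \<le> size {#e \<in># edges G. fst e = p#}"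
    by (rule size_mset_mono)
  with simple show False
    unfolding no_multiple_edges_def
    by (metis Suc_n_not_le_n One_nat_def le_trans size_add_mset size_empty)
qed

text \<open>Justifies the definite description in \<open>edge_weight\<close>: existence comes from
  \<open>neighbours\<close>, uniqueness from \<open>edge_unique\<close>.\<close>

lemma edge_iff_weight:
  "({v, w}, a) \<in># edges G \<longleftrightarrow> w \<in> neighbours G v \<and> a = edge_weight G v w"
proof
  assume "({v, w}, a) \<in># edges G"
  then show "w \<in> neighbours G v \<and> a = edge_weight G v w"
    unfolding neighbours_def edge_weight_def
    using edge_unique by (auto intro!: the_equality[symmetric])
next
  assume w: "w \<in> neighbours G v \<and> a = edge_weight G v w"
  then obtain b where b: "({v, w}, b) \<in># edges G"
    by (auto simp: neighbours_def)
  then have "edge_weight G v w = b"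
    unfolding edge_weight_def using edge_unique by (intro the_equality) auto
  with b w show "({v, w}, a) \<in># edges G" by simp
qed

lemma neighbours_subset: "neighbours G v \<subseteq> verts G - {v}"
  using wf unfolding neighbours_def edge_weighted_graph_def by fastforce

lemma finite_neighbours: "finite (neighbours G v)"
  using neighbours_subset wf unfolding edge_weighted_graph_def
  by (meson finite_Diff finite_subset)

lemma set_mset_edges_star_clique:
  "set_mset (edges (star_clique v G)) =
     {e. e \<in># edges G \<and> v \<notin> fst e} \<union>
     {({w, w'}, gcd (edge_weight G v w) (edge_weight G v w')) |w w'.
        w \<in> neighbours G v \<and> w' \<in> neighbours G v \<and> w < w'}"
proof -
  \<comment> \<open>Finiteness matters because \<open>mset_set\<close> of an infinite set is
    empty.\<close>
  have "finite {(w, w'). w \<in> neighbours G v \<and> w' \<in> neighbours G v \<and> w < w'}"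
    by (rule finite_subset[of _ "neighbours G v \<times> neighbours G v"])
      (auto simp: finite_neighbours)
  then show ?thesis
    unfolding star_clique_def by force
qed

lemma star_clique_wf: "edge_weighted_graph (star_clique v G)"
proof -
  have E: "q \<subseteq> verts G \<and> card q = 2 \<and> a > 0" if "(q, a) \<in># edges G" for q a
    using wf that unfolding edge_weighted_graph_def by blast
  have W: "edge_weight G v w > 0" if "w \<in> neighbours G v" for w
    using E[of "{v, w}" "edge_weight G v w"] that edge_iff_weight by blast
  have "q \<subseteq> verts G - {v} \<and> card q = 2 \<and> a > 0"
    if "(q, a) \<in># edges (star_clique v G)" for q a
    using that[unfolded set_mset_edges_star_clique]
  proof
    assume "(q, a) \<in> {e. e \<in># edges G \<and> v \<notin> fst e}"
    then show ?thesis using E by auto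
  next
    assume "(q, a) \<in> {({w, w'}, gcd (edge_weight G v w) (edge_weight G v w')) |w w'.
        w \<in> neighbours G v \<and> w' \<in> neighbours G v \<and> w < w'}"
    then show ?thesis using W neighbours_subset by auto
  qed
  moreover have "verts (star_clique v G) = verts G - {v}"
    by (simp add: star_clique_def)
  ultimately show ?thesis
    using wf unfolding edge_weighted_graph_def by auto
qed

text \<open>Isolates the conditions on \<open>f v\<close> as a system of congruences; the other
  conditions are those of the edges that a star-clique on \<open>v\<close> keeps.\<close>

lemma spline_fun_iff_neighbours:
  "spline_fun G f \<longleftrightarrow>
     (\<forall>i j a. ({i, j}, a) \<in># edges G \<and> v \<noteq> i \<and> v \<noteq> j \<longrightarrow> [f i = f j] (mod int a)) \<and>
     (\<forall>w\<in>neighbours G v. [f v = f w] (mod int (edge_weight G v w)))"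
  (is "_ \<longleftrightarrow> ?A \<and> ?B")
proof
  assume "spline_fun G f"
  then show "?A \<and> ?B"
    unfolding spline_fun_def using edge_iff_weight by blast
next
  assume AB: "?A \<and> ?B"
  have star: "[f v = f w] (mod int a)" if "({v, w}, a) \<in># edges G" for w a
    using conjunct2[OF AB] that by (simp add: edge_iff_weight)
  show "spline_fun G f"
    unfolding spline_fun_def
  proof (intro allI impI)
    fix i j a assume e: "({i, j}, a) \<in># edges G"
    consider "v = i" | "v = j" | "v \<noteq> i" "v \<noteq> j"
      by blast
    then show "[f i = f j] (mod int a)"
    proof cases
      case 1
      with e star show ?thesis by simp
    next
      case 2
      with e star[of i a] show ?thesis by (simp add: insert_commute cong_sym)
    next
      case 3
      with e conjunct1[OF AB] show ?thesis by blast
    qed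
  qed
qed

lemma spline_fun_star_clique_iff:
  "spline_fun (star_clique v G) f \<longleftrightarrow>
     (\<forall>i j a. ({i, j}, a) \<in># edges G \<and> v \<noteq> i \<and> v \<noteq> j \<longrightarrow> [f i = f j] (mod int a)) \<and>
     (\<forall>w\<in>neighbours G v. \<forall>w'\<in>neighbours G v.
        [f w = f w'] (mod gcd (int (edge_weight G v w)) (int (edge_weight G v w'))))"
  (is "_ \<longleftrightarrow> ?A \<and> ?B")
proof
  assume f: "spline_fun (star_clique v G) f"
  have "[f w = f w'] (mod gcd (int (edge_weight G v w)) (int (edge_weight G v w')))"
    if "w \<in> neighbours G v" "w' \<in> neighbours G v" for w w'
    using that
  \<comment> \<open>New edges exist only for \<open>w < w'\<close>. The opposite order follows by
    symmetry, and the diagonal is trivial.\<close>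
  proof (induction w w' rule: linorder_wlog)
    case (le w w')
    show ?case
    proof (cases "w = w'")
      case False
      with le have "({w, w'}, gcd (edge_weight G v w) (edge_weight G v w'))
          \<in># edges (star_clique v G)"
        unfolding set_mset_edges_star_clique
        by (intro UnI2 CollectI exI[of _ w] exI[of _ w']) simp
      with f show ?thesis
        unfolding spline_fun_def by (metis gcd_int_int_eq)
    qed simp
  next
    case (sym w w')
    then show ?case by (simp add: gcd.commute cong_sym)
  qed
  moreover have ?A
    using f unfolding spline_fun_def set_mset_edges_star_clique by auto
  ultimately show "?A \<and> ?B" by blast
next
  assume AB: "?A \<and> ?B"
  show "spline_fun (star_clique v G) f"
    unfolding spline_fun_def
  proof (intro allI impI)
    fix i j a assume "({i, j}, a) \<in># edges (star_clique v G)"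
    then consider "({i, j}, a) \<in># edges G" "v \<noteq> i" "v \<noteq> j"
      | w w' where "w \<in> neighbours G v" "w' \<in> neighbours G v" "{i, j} = {w, w'}"
          "a = gcd (edge_weight G v w) (edge_weight G v w')"
      unfolding set_mset_edges_star_clique by auto
    then show "[f i = f j] (mod int a)"
    proof cases
      case 1
      with AB show ?thesis by blast
    next
      case 2
      then have "[f w = f w'] (mod int a)"
        using AB by (metis gcd_int_int_eq)
      with 2(3) show ?thesis
        by (auto simp: doubleton_eq_iff cong_sym)
    qed
  qed
qed

text \<open>The two preceding characterisations share their first conjunct. The second ones match by
  the Chinese remainder theorem, with \<open>x\<close> the unknown value at
  \<open>v\<close>.\<close>

lemma spline_fun_star_clique:
  "spline_fun (star_clique v G) f \<longleftrightarrow> (\<exists>x. spline_fun G (f(v := x)))"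
proof -
  let ?c = "\<lambda>w. int (edge_weight G v w)"
  have v: "v \<notin> neighbours G v"
    using neighbours_subset by blast
  have "(\<forall>w\<in>neighbours G v. \<forall>w'\<in>neighbours G v. [f w = f w'] (mod gcd (?c w) (?c w'))) \<longleftrightarrow>
      (\<exists>x. \<forall>w\<in>neighbours G v. [x = f w] (mod ?c w))"
    (is "?L \<longleftrightarrow> ?R")
  proof
    assume ?L
    then show ?R
      using chinese_remainder_gcd_int[OF finite_neighbours, of f ?c] by blast
  next
    assume ?R
    then show ?L
      \<comment> \<open>Modulo the gcd of the two weights, \<open>f w\<close> and
        \<open>f w'\<close> are both congruent to \<open>x\<close>.\<close>
      by (meson cong_dvd_modulus cong_sym cong_trans gcd_dvd1 gcd_dvd2)
  qed
  moreover have "spline_fun G (f(v := x)) \<longleftrightarrow>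
      (\<forall>i j a. ({i, j}, a) \<in># edges G \<and> v \<noteq> i \<and> v \<noteq> j \<longrightarrow> [f i = f j] (mod int a)) \<and>
      (\<forall>w\<in>neighbours G v. [x = f w] (mod ?c w))" for x
    unfolding spline_fun_iff_neighbours using v by (auto simp: fun_upd_def)
  ultimately show ?thesis
    unfolding spline_fun_star_clique_iff by blast
qed

end

text \<open>Stated as extendability from \<open>verts H\<close> to \<open>verts G\<close>, a form
  shared by both operations and closed under composition. Well-formedness is carried along so that
  further steps can be applied.\<close>

lemma collapsing_step_spline_fun:
  assumes "collapsing_step G H" "edge_weighted_graph G"
  shows "edge_weighted_graph H \<and> verts H \<subseteq> verts G \<and>
    (\<forall>f. spline_fun H f \<longleftrightarrow> (\<exists>g. (\<forall>i\<in>verts H. g i = f i) \<and> spline_fun G g))"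
  using assms
proof (cases rule: collapsing_step.cases)
  case (star_clique_step v)
  note wf' = star_clique_wf[OF assms(2) star_clique_step(2), of v]
  note sf = spline_fun_star_clique[OF assms(2) star_clique_step(2), of v]
  have verts: "verts H = verts G - {v}"
    by (simp add: star_clique_step star_clique_def)
  have "spline_fun H f \<longleftrightarrow> (\<exists>g. (\<forall>i\<in>verts H. g i = f i) \<and> spline_fun G g)" for f
  proof
    assume "spline_fun H f"
    then obtain x where "spline_fun G (f(v := x))"
      unfolding star_clique_step sf by blast
    then show "\<exists>g. (\<forall>i\<in>verts H. g i = f i) \<and> spline_fun G g"
      unfolding verts by (intro exI[of _ "f(v := x)"]) auto
  next
    assume "\<exists>g. (\<forall>i\<in>verts H. g i = f i) \<and> spline_fun G g"
    then obtain g where g: "\<forall>i\<in>verts H. g i = f i" "spline_fun G g"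
      by blast
    \<comment> \<open>The value to insert at \<open>v\<close> is \<open>g v\<close> itself, which
      leaves \<open>g\<close> unchanged.\<close>
    then have "spline_fun H g"
      unfolding star_clique_step sf by (metis fun_upd_triv)
    with g(1) wf' show "spline_fun H f"
      using spline_fun_cong star_clique_step(1) by metis
  qed
  with wf' verts show ?thesis
    using star_clique_step(1) by blast
next
  case (edge_collapse_step M p)
  note wf' = edge_collapse_wf[OF assms(2) edge_collapse_step(2-4)]
  note sf = spline_fun_edge_collapse[OF edge_collapse_step(2,4)]
  have verts: "verts H = verts G"
    by (simp add: edge_collapse_step edge_collapse_def)
  have "spline_fun H f \<longleftrightarrow> (\<exists>g. (\<forall>i\<in>verts H. g i = f i) \<and> spline_fun G g)" for f
    unfolding verts spline_fun_agree_iff[OF assms(2)] unfolding edge_collapse_step(1) sf ..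
  with wf' verts show ?thesis
    using edge_collapse_step(1) by blast
qed

lemma collapsing_steps_spline_fun:
  assumes "collapsing_step\<^sup>*\<^sup>* G H" "edge_weighted_graph G"
  shows "edge_weighted_graph H \<and> verts H \<subseteq> verts G \<and>
    (\<forall>f. spline_fun H f \<longleftrightarrow> (\<exists>g. (\<forall>i\<in>verts H. g i = f i) \<and> spline_fun G g))"
  using assms(1)
proof (induction rule: rtranclp_induct)
  case base
  have "spline_fun G f \<longleftrightarrow> (\<exists>g. (\<forall>i\<in>verts G. g i = f i) \<and> spline_fun G g)" for f
    by (simp add: spline_fun_agree_iff[OF assms(2)])
  with assms(2) show ?case by blast
next
  case (step H K)
  then have H: "edge_weighted_graph H" "verts H \<subseteq> verts G"
    and GH: "\<And>f. spline_fun H f \<longleftrightarrow> (\<exists>g. (\<forall>i\<in>verts H. g i = f i) \<and> spline_fun G g)"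
    by blast+
  from collapsing_step_spline_fun[OF step.hyps(2) H(1)]
  have K: "edge_weighted_graph K" "verts K \<subseteq> verts H"
    and HK: "\<And>f. spline_fun K f \<longleftrightarrow> (\<exists>h. (\<forall>i\<in>verts K. h i = f i) \<and> spline_fun H h)"
    by blast+
  have "spline_fun K f \<longleftrightarrow> (\<exists>g. (\<forall>i\<in>verts K. g i = f i) \<and> spline_fun G g)" for f
  proof
    assume "spline_fun K f"
    then obtain h where h: "\<forall>i\<in>verts K. h i = f i" "spline_fun H h"
      using HK by blast
    then obtain g where "\<forall>i\<in>verts H. g i = h i" "spline_fun G g"
      using GH by blast
    with h(1) K(2) show "\<exists>g. (\<forall>i\<in>verts K. g i = f i) \<and> spline_fun G g"
      by (metis subsetD)
  next
    assume "\<exists>g. (\<forall>i\<in>verts K. g i = f i) \<and> spline_fun G g"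
    \<comment> \<open>The labelling \<open>g\<close> is its own extension from \<open>H\<close> to
      \<open>G\<close>, hence a spline of \<open>H\<close>, and can serve as
      \<open>h\<close>.\<close>
    then show "spline_fun K f"
      using GH HK by blast
  qed
  with H K show ?case by blast
qed

section \<open>The module of splines\<close>

lemma spline_module_simps [simp]:
  "carrier (spline_module G) = splines G"
  "add (spline_module G) = (+)"
  "zero (spline_module G) = 0\<^sub>v (card (verts G))"
  "smult (spline_module G) = (\<cdot>\<^sub>v)"
  by (simp_all add: spline_module_def module_vec_def)

lemma splines_carrier: "g \<in> splines G \<Longrightarrow> g \<in> carrier_vec (card (verts G))"
  by (simp add: splines_def)

context
  fixes G :: weighted_graph and n :: nat
  assumes wf: "edge_weighted_graph G" and verts: "verts G = {..<n}"
begin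

text \<open>The entrywise rules for vector operations need indices below the dimension.\<close>

lemma edge_bounds:
  assumes "({i, j}, a) \<in># edges G"
  shows "i < n" "j < n"
  using wf assms unfolding edge_weighted_graph_def verts by auto

lemma splines_add: "g \<in> splines G \<Longrightarrow> h \<in> splines G \<Longrightarrow> g + h \<in> splines G"
  using edge_bounds by (auto simp: splines_def verts intro!: cong_add)

lemma splines_smult: "g \<in> splines G \<Longrightarrow> c \<cdot>\<^sub>v g \<in> splines G"
  using edge_bounds by (auto simp: splines_def verts intro!: cong_scalar_left)

lemma splines_zero: "0\<^sub>v n \<in> splines G"
  using edge_bounds by (auto simp: splines_def verts)

lemma module_splines: "module class_ring (spline_module G)"
proof (rule moduleI)
  show "cring (class_ring :: int ring)" ..
  have "\<exists>h\<in>splines G. h + g = 0\<^sub>v n" if "g \<in> splines G" for g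
    using splines_smult[OF that, of "-1"] splines_carrier[OF that]
    by (intro bexI[of _ "-1 \<cdot>\<^sub>v g"]) (auto simp: verts intro!: eq_vecI)
  then show "abelian_group (spline_module G)"
    by (intro abelian_groupI)
      (auto simp: verts splines_add splines_zero
        dest!: splines_carrier intro: assoc_add_vec comm_add_vec left_zero_vec)
qed (auto simp: splines_smult add_smult_distrib_vec smult_smult_assoc
      dest!: splines_carrier intro: smult_add_distrib_vec)

end

section \<open>The restriction map: image and kernel\<close>

theorem theorem3p8:
  fixes G G' :: weighted_graph and n r :: nat
  assumes "edge_weighted_graph G" and "no_multiple_edges G" and "verts G = {..<n}"
    and "collapsing_step\<^sup>*\<^sup>* G G'" and "no_multiple_edges G'" and "verts G' = {..<r}"
  shows "let \<phi> = (\<lambda>g :: int vec. vec_first g r) in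
    mod_hom class_ring (spline_module G) (spline_module G') \<phi> \<and>
    \<phi> ` carrier (spline_module G) = carrier (spline_module G') \<and>
    mod_hom.ker (spline_module G) (spline_module G') \<phi> = (\<Union>i\<in>{r..n}. flow_up_class G i)"
proof -
  define \<phi> where "\<phi> = (\<lambda>g :: int vec. vec_first g r)"
  note wf = assms(1) and vG = assms(3) and vG' = assms(6)
  from collapsing_steps_spline_fun[OF assms(4) wf]
  have wf': "edge_weighted_graph G'" and "r \<le> n"
    and GG': "\<And>f. spline_fun G' f \<longleftrightarrow> (\<exists>g. (\<forall>i<r. g i = f i) \<and> spline_fun G g)"
    unfolding vG vG' by auto
  have \<phi>_nth: "\<phi> g $ i = g $ i" if "i < r" for g i
    using that by (simp add: \<phi>_def vec_first_def)
  have dim_\<phi>: "dim_vec (\<phi> g) = r" for g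
    by (simp add: \<phi>_def)
  have \<phi>_splines: "\<phi> g \<in> splines G'" if "g \<in> splines G" for g
  proof -
    have "spline_fun G (($) g)"
      using that by (simp add: splines_eq)
    then have "spline_fun G' (($) (\<phi> g))"
      unfolding GG' by (intro exI[of _ "($) g"]) (simp add: \<phi>_nth)
    moreover have "\<phi> g \<in> carrier_vec r"
      by (simp add: \<phi>_def)
    ultimately show ?thesis
      by (simp add: splines_eq vG')
  qed
  have im: "\<phi> ` splines G = splines G'"
  proof
    show "splines G' \<subseteq> \<phi> ` splines G"
    proof
      fix h assume h: "h \<in> splines G'"
      then obtain g where g: "\<forall>i<r. g i = h $ i" "spline_fun G g"
        unfolding splines_eq using GG'[of "($) h"] by blast
      \<comment> \<open>The extension \<open>g\<close> is a total function; cutting it off at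
        \<open>n\<close> turns it into a vector without changing it on the vertices.\<close>
      have "spline_fun G (($) (vec n g))"
        using g(2) by (subst spline_fun_cong[OF wf, of _ g]) (auto simp: vG)
      then have "vec n g \<in> splines G"
        by (simp add: splines_eq vG)
      moreover have "h = \<phi> (vec n g)"
        using splines_carrier[OF h] g(1) \<open>r \<le> n\<close>
        by (intro eq_vecI) (auto simp: vG' \<phi>_nth dim_\<phi>)
      ultimately show "h \<in> \<phi> ` splines G" by blast
    qed
  qed (use \<phi>_splines in blast)
  have hom: "mod_hom class_ring (spline_module G) (spline_module G') \<phi>"
  proof (intro mod_hom.intro mod_hom_axioms.intro)
    show "\<phi> \<in> LinearCombinations.module_hom class_ring (spline_module G) (spline_module G')"
      using \<phi>_splines \<open>r \<le> n\<close> unfolding LinearCombinations.module_hom_def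
      by (auto simp: vG dim_\<phi> \<phi>_nth intro!: eq_vecI dest!: splines_carrier)
  qed (rule module_splines[OF wf vG] module_splines[OF wf' vG'])+
  have \<phi>_zero: "\<phi> g = 0\<^sub>v r \<longleftrightarrow> (\<forall>i<r. g $ i = 0)" for g
    by (auto simp: vec_eq_iff dim_\<phi> \<phi>_nth)
  have "{g \<in> splines G. \<phi> g = 0\<^sub>v r} = (\<Union>i\<in>{r..n}. flow_up_class G i)"
  proof (intro equalityI subsetI)
    fix g assume "g \<in> {g \<in> splines G. \<phi> g = 0\<^sub>v r}"
    then have g: "g \<in> splines G" "\<forall>i<r. g $ i = 0"
      by (auto simp: \<phi>_zero)
    show "g \<in> (\<Union>i\<in>{r..n}. flow_up_class G i)"
    \<comment> \<open>The first nonzero index \<open>k\<close> of \<open>g\<close> places it in the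
      class of \<open>k\<close>, and \<open>k\<close> is at least \<open>r\<close>. If there is
      none, \<open>g\<close> is zero and lies in the class of \<open>n\<close>, which is the
      singleton of the zero vector.\<close>
    proof (cases "\<exists>i<n. g $ i \<noteq> 0")
      case True
      then obtain k where k: "k < n" and nz: "g $ k \<noteq> 0" and least: "\<forall>i<k. g $ i = 0"
        unfolding exists_least_iff[of "\<lambda>i. i < n \<and> g $ i \<noteq> 0"] by auto
      have "r \<le> k"
        using nz g(2) by (meson not_le)
      then show ?thesis
        using g k nz least by (auto simp: flow_up_class_def vG intro!: bexI[of _ k])
    next
      case False
      then have "g = 0\<^sub>v n"
        using splines_carrier[OF g(1)] by (intro eq_vecI) (auto simp: vG)
      then show ?thesis
        using \<open>r \<le> n\<close> by (auto simp: flow_up_class_def vG intro!: bexI[of _ n])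
    qed
  next
    fix g assume "g \<in> (\<Union>i\<in>{r..n}. flow_up_class G i)"
    then show "g \<in> {g \<in> splines G. \<phi> g = 0\<^sub>v r}"
      using splines_zero[OF wf vG] \<open>r \<le> n\<close>
      by (auto simp: flow_up_class_def vG \<phi>_zero split: if_splits)
  qed
  then have "mod_hom.ker (spline_module G) (spline_module G') \<phi> =
      (\<Union>i\<in>{r..n}. flow_up_class G i)"
    by (simp add: mod_hom.ker_def[OF hom] vG')
  with hom im show ?thesis
    unfolding Let_def \<phi>_def by simp
qed

end
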